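(* Every planar graph $G$ with $n$ vertices and $m\geq 3$ edges satisfies $c(G)\leq n+\frac{7}{3}m-2$.
   Context: All graphs are finite, simple and undirected. A clique of a graph $G$ is a (possibly empty) set of pairwise adjacent vertices; $c(G)$ denotes the number of cliques of $G$ (including the empty clique, all single vertices and all edges). *)

theory Defs
  imports "HOL-Analysis.Analysis"
begin

definition simple_graph :: "'a set \<Rightarrow> 'a set set \<Rightarrow> bool" where
  "simple_graph V E \<longleftrightarrow> finite V \<and> (\<forall>e\<in>E. e \<subseteq> V \<and> card e = 2)"

definition cliques :: "'a set \<Rightarrow> 'a set set \<Rightarrow> 'a set set" where
  "cliques V E = {C. C \<subseteq> V \<and> (\<forall>x\<in>C. \<forall>y\<in>C. x \<noteq> y \<longrightarrow> {x, y} \<in> E)}"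

definition num_cliques :: "'a set \<Rightarrow> 'a set set \<Rightarrow> nat" where
  "num_cliques V E = card (cliques V E)"

definition planar :: "'a set \<Rightarrow> 'a set set \<Rightarrow> bool" where
  "planar V E \<longleftrightarrow>
     (\<exists>(pos :: 'a \<Rightarrow> complex) (\<gamma> :: 'a set \<Rightarrow> real \<Rightarrow> complex).
        inj_on pos V \<and>
        (\<forall>e\<in>E. arc (\<gamma> e) \<and> {pathstart (\<gamma> e), pathfinish (\<gamma> e)} = pos ` e \<and>
                path_image (\<gamma> e) \<inter> pos ` V = pos ` e) \<and>
        (\<forall>e\<in>E. \<forall>e'\<in>E. e \<noteq> e' \<longrightarrow>
                path_image (\<gamma> e) \<inter> path_image (\<gamma> e') \<subseteq> pos ` (e \<inter> e')))"

end

theory Submission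
  imports Defs
begin

text \<open>It suffices to show that the number \<open>t\<close> of cliques with at least three vertices satisfies
  \<open>3 * t + 9 \<le> 4 * m\<close>; isolated vertices play no role. If some triangle has edges on both of its
  sides, the graph splits along it into two smaller graphs that share only that triangle; then \<open>t\<close>
  adds up to one more and \<open>m\<close> to three more, which preserves the bound. Otherwise every triangle
  has an empty side, and since an arc cannot border three empty sides, every edge lies in at most two
  triangles. Then there is no \<open>K5\<close>, copies of \<open>K4\<close> are edge-disjoint, and double counting
  gives at most \<open>2 * m / 3\<close> triangles and \<open>m / 6\<close> copies of \<open>K4\<close>. Euler's formula is
  not needed.\<close>

section \<open>Sides of Jordan curves\<close>

text \<open>A property of the point set, so that a union of edge images qualifies without a chosen
  parametrisation or orientation.\<close>

definition jordan_curve :: "complex set \<Rightarrow> bool" where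
  "jordan_curve C \<longleftrightarrow> (\<exists>c. simple_path c \<and> pathfinish c = pathstart c \<and> path_image c = C)"

text \<open>Inside and outside are treated alike, because the side of a triangle that carries no
  edges may be the unbounded one.\<close>

definition sides :: "complex set \<Rightarrow> complex set set" where
  "sides C = {inside C, outside C}"

lemma jordan_curve_join:
  assumes "arc g" "arc h" "pathstart g = a" "pathfinish g = b" "pathstart h = a" "pathfinish h = b"
    and "path_image g \<inter> path_image h \<subseteq> {a, b}"
  shows "jordan_curve (path_image g \<union> path_image h)"
proof -
  have "simple_path (g +++ reversepath h)"
    by (rule simple_path_join_loop) (use assms in \<open>auto simp: arc_reversepath\<close>)
  moreover have "path_image (g +++ reversepath h) = path_image g \<union> path_image h"
    using assms by (simp add: path_image_join)
  ultimately show ?thesis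
    unfolding jordan_curve_def using assms by (intro exI[of _ "g +++ reversepath h"]) auto
qed

lemma
  assumes "jordan_curve C"
  shows jordan_curve_compact: "compact C"
    and jordan_curve_inside_outside: "inside C \<inter> outside C = {}" "inside C \<union> outside C = - C"
proof -
  obtain c where c: "simple_path c" "pathfinish c = pathstart c" "path_image c = C"
    using assms unfolding jordan_curve_def by blast
  show "compact C" "inside C \<inter> outside C = {}" "inside C \<union> outside C = - C"
    using c Jordan_inside_outside[OF c(1,2)] compact_simple_path_image by auto
qed

lemma
  assumes "jordan_curve C" "S \<in> sides C"
  shows side_nonempty: "S \<noteq> {}"
    and side_open: "open S"
    and side_connected: "connected S"
    and side_frontier: "frontier S = C"
    and side_disjoint: "S \<inter> C = {}"
    and side_opposite: "- C - S \<in> sides C"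
proof -
  obtain c where c: "simple_path c" "pathfinish c = pathstart c" "path_image c = C"
    using assms unfolding jordan_curve_def by blast
  note J = Jordan_inside_outside[OF c(1,2), unfolded c(3)]
  have S: "S = inside C \<or> S = outside C"
    using assms(2) unfolding sides_def by blast
  show "S \<noteq> {}" "open S" "connected S" "frontier S = C"
    using J S by metis+
  show "S \<inter> C = {}"
    using S inside_no_overlap outside_no_overlap by blast
  have "- C - inside C = outside C" "- C - outside C = inside C"
    using J by blast+
  then show "- C - S \<in> sides C"
    using S unfolding sides_def by auto
qed

text \<open>A connected set that meets \<open>S\<close> without lying in it meets the frontier of
  \<open>S\<close>, which by the Jordan curve theorem is all of \<open>C\<close>.\<close>

lemma connected_subset_side:
  assumes "jordan_curve C" "connected X" "X \<inter> C = {}" "S \<in> sides C" "X \<inter> S \<noteq> {}"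
  shows "X \<subseteq> S"
  using connected_Int_frontier[of X S] side_frontier[of C S] assms by blast

lemma side_meets_neighbourhood:
  assumes "jordan_curve C" "S \<in> sides C" "p \<in> C" "open U" "p \<in> U"
  shows "S \<inter> U \<noteq> {}"
proof -
  have "p \<in> closure S"
    using side_frontier[OF assms(1,2)] assms(3) by (auto simp: frontier_def)
  then show ?thesis
    using assms(4,5) open_Int_closure_eq_empty[of U S] by blast
qed

text \<open>Both points lie on the side opposite to \<open>S\<close>, which is connected. This
  provides the hypotheses of Janiszewski's theorem.\<close>

lemma side_connected_component:
  assumes "jordan_curve C" "S \<in> sides C" "p \<notin> C" "p \<notin> S" "q \<notin> C" "q \<notin> S"
  shows "connected_component (- C) p q"
  using side_connected[OF assms(1) side_opposite[OF assms(1,2)]] assms(3-6)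
  unfolding connected_component_def by (intro exI[of _ "- C - S"]) auto

text \<open>Since neither side meets the other's curve, overlapping sides would contain each other;
  equal sides have equal frontiers, hence equal curves.\<close>

lemma sides_of_curves_disjoint:
  assumes "jordan_curve C" "S \<in> sides C" "jordan_curve C'" "S' \<in> sides C'"
    and "S \<inter> C' = {}" "S' \<inter> C = {}" "C \<noteq> C'"
  shows "S \<inter> S' = {}"
proof (rule ccontr)
  assume "S \<inter> S' \<noteq> {}"
  then have "S \<subseteq> S'" "S' \<subseteq> S"
    using connected_subset_side[OF assms(3) _ assms(5,4)] connected_subset_side[OF assms(1) _ assms(6,2)]
      side_connected assms(1-4) by blast+
  then have "S = S'"
    by blast
  then show False
    using side_frontier[OF assms(1,2)] side_frontier[OF assms(3,4)] assms(7) by simp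
qed

text \<open>The arc without its ends is connected and dense in the arc, and every set between a
  connected set and its closure is connected. Later \<open>F\<close> consists of both ends, or of
  those ends of an edge that lie on a triangle.\<close>

lemma arc_endless_subset_connected:
  assumes "arc g" "F \<subseteq> {pathstart g, pathfinish g}"
  shows "connected (path_image g - F)"
proof (rule connected_intermediate_closure)
  let ?I = "path_image g - {pathstart g, pathfinish g}"
  show "connected ?I"
    by (simp add: arc_imp_simple_path assms(1) connected_simple_path_endless)
  show "?I \<subseteq> path_image g - F"
    using assms(2) by blast
  have "g ` closure {0<..<1} \<subseteq> closure (g ` {0<..<1})"
    by (rule image_closure_subset)
      (use assms(1) in \<open>auto simp: arc_def path_def closure_subset\<close>)
  then have "path_image g \<subseteq> closure ?I"
    by (simp add: path_image_def simple_path_endless[OF arc_imp_simple_path[OF assms(1)], unfolded path_image_def])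
  then show "path_image g - F \<subseteq> closure ?I"
    by blast
qed

text \<open>An arc has only two sides: writing \<open>A\<close>, \<open>B1\<close>, \<open>B2\<close> for the images of \<open>p\<close>, \<open>g1\<close>, \<open>g2\<close>, the
  arc \<open>A\<close> together with \<open>S1\<close>, \<open>S2\<close>, \<open>S3\<close> lies on one side of \<open>B1 \<union> B2\<close>, and yet Janiszewski's theorem,
  applied to two curves that meet in the connected set \<open>A\<close>, joins \<open>S3\<close> to the other side.\<close>

lemma no_arc_on_three_empty_sides:
  assumes arcs: "arc p" "arc g1" "arc g2" "arc g3"
    and start: "pathstart p = a" "pathstart g1 = a" "pathstart g2 = a" "pathstart g3 = a"
    and finish: "pathfinish p = b" "pathfinish g1 = b" "pathfinish g2 = b" "pathfinish g3 = b"
    and p_g: "path_image p \<inter> path_image g1 \<subseteq> {a, b}" "path_image p \<inter> path_image g2 \<subseteq> {a, b}"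
      "path_image p \<inter> path_image g3 \<subseteq> {a, b}"
    and g_g: "path_image g1 \<inter> path_image g2 \<subseteq> {a, b}" "path_image g1 \<inter> path_image g3 \<subseteq> {a, b}"
      "path_image g2 \<inter> path_image g3 \<subseteq> {a, b}"
    and sides: "S1 \<in> sides (path_image p \<union> path_image g1)"
      "S2 \<in> sides (path_image p \<union> path_image g2)" "S3 \<in> sides (path_image p \<union> path_image g3)"
    and empty: "S1 \<inter> (path_image g2 \<union> path_image g3) = {}"
      "S2 \<inter> (path_image g1 \<union> path_image g3) = {}" "S3 \<inter> (path_image g1 \<union> path_image g2) = {}"
  shows False
proof -
  define A B1 B2 B3 where
    AB: "A = path_image p" "B1 = path_image g1" "B2 = path_image g2" "B3 = path_image g3"
  have J: "jordan_curve (A \<union> B1)" "jordan_curve (A \<union> B2)" "jordan_curve (A \<union> B3)"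
      "jordan_curve (B1 \<union> B2)"
    unfolding AB by (rule jordan_curve_join[of _ _ a b]; use assms in blast)+
  have inner: "A - {a, b} \<noteq> {}" "B3 - {a, b} \<noteq> {}"
    using nonempty_simple_path_endless[OF arc_imp_simple_path[OF arcs(1)]]
      nonempty_simple_path_endless[OF arc_imp_simple_path[OF arcs(4)]]
    unfolding AB start finish .
  have ends: "{a, b} \<subseteq> A" "{a, b} \<subseteq> B1" "{a, b} \<subseteq> B2"
    unfolding AB using start finish pathstart_in_path_image pathfinish_in_path_image
    by (metis empty_subsetI insert_subset)+
  have AB_Int: "A \<inter> B1 \<subseteq> {a, b}" "A \<inter> B2 \<subseteq> {a, b}" "A \<inter> B3 \<subseteq> {a, b}"
      "B1 \<inter> B2 \<subseteq> {a, b}" "B1 \<inter> B3 \<subseteq> {a, b}" "B2 \<inter> B3 \<subseteq> {a, b}"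
    unfolding AB using p_g g_g by blast+
  have S: "S1 \<in> sides (A \<union> B1)" "S2 \<in> sides (A \<union> B2)" "S3 \<in> sides (A \<union> B3)"
    and S_B: "S1 \<inter> (B2 \<union> B3) = {}" "S2 \<inter> (B1 \<union> B3) = {}" "S3 \<inter> (B1 \<union> B2) = {}"
    using sides empty unfolding AB by blast+
  note S_own = side_disjoint[OF J(1) S(1)] side_disjoint[OF J(2) S(2)] side_disjoint[OF J(3) S(3)]
  \<comment> \<open>The inner points of \<open>B3\<close> lie on none of \<open>A\<close>,
    \<open>B1\<close>, \<open>B2\<close>.\<close>
  have ne: "A \<union> B1 \<noteq> A \<union> B3" "A \<union> B2 \<noteq> A \<union> B3"
    using inner(2) AB_Int(3,5,6) by blast+
  have S13: "S1 \<inter> S3 = {}" and S23: "S2 \<inter> S3 = {}"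
    by (rule sides_of_curves_disjoint[OF J(1) S(1) J(3) S(3) _ _ ne(1)]
        sides_of_curves_disjoint[OF J(2) S(2) J(3) S(3) _ _ ne(2)]; use S_B S_own in blast)+
  obtain m where m: "m \<in> A" "m \<noteq> a" "m \<noteq> b"
    using inner(1) by blast
  then have m_notin: "m \<notin> B1 \<union> B2"
    using AB_Int by blast
  \<comment> \<open>One inner point \<open>m\<close> of \<open>A\<close> selects the side
    \<open>D\<close> of \<open>B1 \<union> B2\<close>; connectedness then brings all other inner
    points of \<open>A\<close> into \<open>D\<close>.\<close>
  obtain D where D: "D \<in> sides (B1 \<union> B2)" "m \<in> D"
    using m_notin jordan_curve_inside_outside[OF J(4)] unfolding sides_def by blast
  have D_open: "open D"
    using side_open J(4) D(1) by blast
  have "A - {a, b} \<subseteq> D"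
  proof (rule connected_subset_side[OF J(4) _ _ D(1)])
    show "connected (A - {a, b})"
      unfolding AB by (rule arc_endless_subset_connected) (use arcs start finish in auto)
    show "(A - {a, b}) \<inter> (B1 \<union> B2) = {}" "(A - {a, b}) \<inter> D \<noteq> {}"
      using AB_Int m D by blast+
  qed
  then have A_sub: "A \<subseteq> D \<union> B1 \<union> B2"
    using ends by blast
  \<comment> \<open>The point \<open>m\<close> is on the frontier of all three sides, so each of
    them reaches into the open set \<open>D\<close>.\<close>
  have SD: "S1 \<inter> D \<noteq> {}" "S2 \<inter> D \<noteq> {}" "S3 \<inter> D \<noteq> {}"
    using side_meets_neighbourhood[OF J(1) S(1) UnI1[OF m(1)] D_open D(2)]
      side_meets_neighbourhood[OF J(2) S(2) UnI1[OF m(1)] D_open D(2)]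
      side_meets_neighbourhood[OF J(3) S(3) UnI1[OF m(1)] D_open D(2)] .
  have "S1 \<inter> (B1 \<union> B2) = {}" "S2 \<inter> (B1 \<union> B2) = {}"
    using S_B(1,2) S_own(1,2) by blast+
  then have S1D: "S1 \<subseteq> D" and S2D: "S2 \<subseteq> D"
    using connected_subset_side[OF J(4) side_connected[OF J(1) S(1)] _ D(1) SD(1)]
      connected_subset_side[OF J(4) side_connected[OF J(2) S(2)] _ D(1) SD(2)] by simp_all
  \<comment> \<open>The points \<open>q\<close> and \<open>r\<close> are separated by
    \<open>B1 \<union> B2\<close>. Both avoid \<open>S1\<close> and \<open>S2\<close>, so neither
    \<open>A \<union> B1\<close> nor \<open>A \<union> B2\<close> separates them, and by
    Janiszewski's theorem neither does the union of these two curves, which contains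
    \<open>B1 \<union> B2\<close>.\<close>
  obtain q where q: "q \<in> S3" "q \<in> D"
    using SD(3) by blast
  obtain r where r: "r \<notin> B1 \<union> B2" "r \<notin> D"
    using side_nonempty[OF J(4) side_opposite[OF J(4) D(1)]] by blast
  have qn: "q \<notin> A \<union> B1" "q \<notin> A \<union> B2" "q \<notin> S1" "q \<notin> S2"
    using q(1) S_B(3) S_own(3) S13 S23 by blast+
  have rn: "r \<notin> A \<union> B1" "r \<notin> A \<union> B2" "r \<notin> S1" "r \<notin> S2"
    using r A_sub S1D S2D by auto
  have "connected_component (- ((A \<union> B1) \<union> (A \<union> B2))) q r"
  proof (rule Janiszewski)
    have "(A \<union> B1) \<inter> (A \<union> B2) = A"
      using AB_Int ends by blast
    then show "connected ((A \<union> B1) \<inter> (A \<union> B2))"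
      unfolding AB using arcs(1) connected_arc_image by metis
    show "compact (A \<union> B1)" "closed (A \<union> B2)"
      using J jordan_curve_compact compact_imp_closed by blast+
    show "connected_component (- (A \<union> B1)) q r" "connected_component (- (A \<union> B2)) q r"
      using side_connected_component[OF J(1) S(1) qn(1,3) rn(1,3)]
        side_connected_component[OF J(2) S(2) qn(2,4) rn(2,4)] .
  qed
  then obtain X where X: "connected X" "X \<subseteq> - ((A \<union> B1) \<union> (A \<union> B2))" "q \<in> X" "r \<in> X"
    unfolding connected_component_def by blast
  then have "X \<subseteq> D"
    using connected_subset_side[OF J(4) X(1) _ D(1)] q by blast
  then show False
    using X r by blast
qed

section \<open>Counting cliques with at least three vertices\<close>

text \<open>No vertex set occurs: such cliques are covered by their edges, so that a graph can be
  split by splitting its edge set alone.\<close>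

definition big_cliques :: "'a set set \<Rightarrow> 'a set set" where
  "big_cliques E = {K. finite K \<and> 3 \<le> card K \<and> (\<forall>x\<in>K. \<forall>y\<in>K. x \<noteq> y \<longrightarrow> {x, y} \<in> E)}"

definition pairs :: "'a set \<Rightarrow> 'a set set" where
  "pairs T = {e. e \<subseteq> T \<and> card e = 2}"

lemma card_pairs: "finite T \<Longrightarrow> card (pairs T) = card T choose 2"
  unfolding pairs_def by (rule n_subsets)

lemma pairs_triple:
  assumes "a \<noteq> b" "b \<noteq> c" "a \<noteq> c"
  shows "pairs {a, b, c} = {{a, b}, {b, c}, {a, c}}"
  using assms unfolding pairs_def by (auto simp: card_2_iff doubleton_eq_iff)

lemma big_clique_iff:
  "K \<in> big_cliques E \<longleftrightarrow> finite K \<and> 3 \<le> card K \<and> pairs K \<subseteq> E"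
proof -
  have "e \<in> pairs K \<longleftrightarrow> (\<exists>x\<in>K. \<exists>y\<in>K. x \<noteq> y \<and> e = {x, y})" for e
    unfolding pairs_def by (auto simp: card_2_iff)
  then have "pairs K \<subseteq> E \<longleftrightarrow> (\<forall>x\<in>K. \<forall>y\<in>K. x \<noteq> y \<longrightarrow> {x, y} \<in> E)"
    unfolding subset_iff by metis
  then show ?thesis
    unfolding big_cliques_def by simp
qed

lemma big_clique_subset_Union:
  assumes "K \<in> big_cliques E"
  shows "K \<subseteq> \<Union>E"
proof
  fix x assume x: "x \<in> K"
  have "K - {x} \<noteq> {}"
  proof
    assume "K - {x} = {}"
    then have "card K \<le> card {x}" by (intro card_mono) auto
    then show False using assms unfolding big_cliques_def by simp
  qed
  then show "x \<in> \<Union>E"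
    using x assms unfolding big_cliques_def by blast
qed

lemma finite_big_cliques:
  assumes "finite E" "\<forall>e\<in>E. card e = 2"
  shows "finite (big_cliques E)"
proof -
  have "finite (\<Union>E)"
    using assms by (metis card.infinite finite_Union zero_neq_numeral)
  moreover have "big_cliques E \<subseteq> Pow (\<Union>E)"
    using big_clique_subset_Union by blast
  ultimately show ?thesis
    using finite_subset by blast
qed

text \<open>Double counting of the incidences \<open>e \<subseteq> K\<close>: each \<open>K\<close>
  has \<open>k choose 2\<close> edges, and each edge lies in at most \<open>d\<close> members of
  \<open>F\<close>.\<close>

lemma card_cliques_mult_le:
  assumes "finite E" "finite F" "\<And>K. K \<in> F \<Longrightarrow> finite K \<and> card K = k \<and> pairs K \<subseteq> E"
    and "\<And>e. e \<in> E \<Longrightarrow> card {K \<in> F. e \<subseteq> K} \<le> d"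
    and "\<forall>e\<in>E. card e = 2"
  shows "card F * (k choose 2) \<le> d * card E"
proof -
  have "card F * (k choose 2) = (\<Sum>K\<in>F. card (pairs K))"
    using assms(3) by (simp add: card_pairs)
  also have "\<dots> = (\<Sum>K\<in>F. card {e \<in> E. e \<subseteq> K})"
    by (intro sum.cong refl arg_cong[of _ _ card]) (use assms(3,5) in \<open>auto simp: pairs_def\<close>)
  also have "\<dots> = (\<Sum>K\<in>F. \<Sum>e\<in>E. if e \<subseteq> K then 1 else 0)"
    using assms(1) by (simp add: sum.If_cases Int_def)
  also have "\<dots> = (\<Sum>e\<in>E. \<Sum>K\<in>F. if e \<subseteq> K then 1 else 0)"
    by (rule sum.swap)
  also have "\<dots> = (\<Sum>e\<in>E. card {K \<in> F. e \<subseteq> K})"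
    using assms(2) by (simp add: sum.If_cases Int_def)
  also have "\<dots> \<le> (\<Sum>e\<in>E. d)"
    using assms(4) by (rule sum_mono)
  finally show ?thesis
    by (simp add: mult.commute)
qed

text \<open>With m edges, double counting gives at most 2m/3 triangles and m/6 copies of K4, and
  there are no larger cliques. Then 3t is at most 5m/2, which suffices once m is at least 6; K4
  attains equality. Smaller m need integrality.\<close>

lemma card_big_cliques_codegree_le_2:
  fixes E :: "'a set set"
  assumes fin: "finite E" and two: "\<forall>e\<in>E. card e = 2" and m: "3 \<le> card E"
    and codeg: "\<And>a b. {a, b} \<in> E \<Longrightarrow> card {x. {a, x} \<in> E \<and> {x, b} \<in> E} \<le> 2"
  shows "3 * card (big_cliques E) + 9 \<le> 4 * card E"
proof -
  define N where "N a b = {x. {a, x} \<in> E \<and> {x, b} \<in> E}" for a b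
  have finN: "finite (N a b)" for a b
  proof -
    have "N a b \<subseteq> \<Union>E" unfolding N_def by blast
    moreover have "finite (\<Union>E)"
      using fin two by (metis card.infinite finite_Union zero_neq_numeral)
    ultimately show ?thesis using finite_subset by blast
  qed
  have edgeD: "\<exists>a b. e = {a, b} \<and> a \<noteq> b" if "e \<in> E" for e
    using that two by (metis card_2_iff)
  have sub_N: "K - {a, b} \<subseteq> N a b" if "K \<in> big_cliques E" "a \<in> K" "b \<in> K" for K a b
    using that unfolding N_def big_cliques_def by auto
  have card_diff: "card (K - {a, b}) = card K - 2"
    if "K \<in> big_cliques E" "a \<in> K" "b \<in> K" "a \<noteq> b" for K a b
    using that by (subst card_Diff_subset) auto
  define F where "F k = {K \<in> big_cliques E. card K = k}" for k
  have finF: "finite (F k)" for k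
    unfolding F_def using finite_big_cliques[OF fin two] by auto
  have split: "big_cliques E = F 3 \<union> F 4"
  proof -
    \<comment> \<open>All vertices of a clique other than \<open>a\<close> and \<open>b\<close> are
      common neighbours of \<open>a\<close> and \<open>b\<close>, and there are at most two of
      these.\<close>
    have "card K \<le> 4" if K: "K \<in> big_cliques E" for K
    proof -
      obtain a b where ab: "a \<in> K" "b \<in> K" "a \<noteq> b"
      proof -
        obtain L where "L \<subseteq> K" "card L = 2"
          using K obtain_subset_with_card_n[of 2 K] unfolding big_clique_iff
          by (metis numeral_le_iff order_trans semiring_norm(68,70,72))
        then show ?thesis using that by (auto simp: card_2_iff)
      qed
      have "card (K - {a, b}) \<le> card (N a b)"
        using sub_N[OF K ab(1,2)] finN card_mono by blast
      also have "\<dots> \<le> 2"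
        using codeg[of a b] K ab unfolding N_def big_cliques_def by blast
      finally show ?thesis using card_diff[OF K ab] by linarith
    qed
    then show ?thesis unfolding F_def big_cliques_def by force
  qed
  have "card (F 3) * (3 choose 2) \<le> 2 * card E"
  proof (rule card_cliques_mult_le[OF fin finF _ _ two])
    fix e assume e: "e \<in> E"
    then obtain a b where ab: "e = {a, b}" "a \<noteq> b" using edgeD by blast
    have "{K \<in> F 3. e \<subseteq> K} \<subseteq> (\<lambda>x. {a, b, x}) ` N a b"
    proof
      fix K assume "K \<in> {K \<in> F 3. e \<subseteq> K}"
      then have K: "K \<in> big_cliques E" "card K = 3" "a \<in> K" "b \<in> K"
        unfolding F_def ab by auto
      then have "card (K - {a, b}) = 1" using card_diff ab(2) by simp
      then obtain x where "K - {a, b} = {x}" by (metis card_1_singletonE)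
      then show "K \<in> (\<lambda>x. {a, b, x}) ` N a b"
        using sub_N[OF K(1,3,4)] K(3,4) by (intro image_eqI[of _ _ x]) auto
    qed
    then have "card {K \<in> F 3. e \<subseteq> K} \<le> card (N a b)"
      using finN surj_card_le by blast
    also have "\<dots> \<le> 2" using codeg e ab unfolding N_def by blast
    finally show "card {K \<in> F 3. e \<subseteq> K} \<le> 2" .
  qed (auto simp: F_def big_clique_iff)
  then have 3: "3 * card (F 3) \<le> 2 * card E" by (simp add: numeral_eq_Suc)
  have "card (F 4) * (4 choose 2) \<le> 1 * card E"
  proof (rule card_cliques_mult_le[OF fin finF _ _ two])
    fix e assume e: "e \<in> E"
    then obtain a b where ab: "e = {a, b}" "a \<noteq> b" using edgeD by blast
    \<comment> \<open>A K4 through an edge uses up both common neighbours, so the edge determines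
      it. This gives \<open>d = 1\<close> in the double count.\<close>
    have "K = N a b \<union> {a, b}" if "K \<in> {K \<in> F 4. e \<subseteq> K}" for K
    proof -
      have K: "K \<in> big_cliques E" "card K = 4" "a \<in> K" "b \<in> K"
        using that unfolding F_def ab by auto
      then have "card (K - {a, b}) = 2" using card_diff ab(2) by simp
      then have "K - {a, b} = N a b"
        using codeg[of a b] e ab(1) sub_N[OF K(1,3,4)] finN
        by (metis N_def card_seteq)
      then show ?thesis using K by blast
    qed
    then have "{K \<in> F 4. e \<subseteq> K} \<subseteq> {N a b \<union> {a, b}}" by blast
    then show "card {K \<in> F 4. e \<subseteq> K} \<le> 1"
      by (metis card_mono finite.emptyI finite.insertI is_singletonI is_singleton_altdef)
  qed (auto simp: F_def big_clique_iff)
  then have 4: "6 * card (F 4) \<le> card E" by (simp add: numeral_eq_Suc)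
  \<comment> \<open>For three edges double counting would still allow two triangles, one too many. A
    triangle uses all three edges, so its vertex set is \<open>\<Union>E\<close>.\<close>
  have le1: "card (F 3) \<le> 1" if "card E = 3"
  proof -
    have "T = \<Union>E" if T: "T \<in> F 3" for T
    proof -
      have "finite T" "card T = 3" "pairs T \<subseteq> E" "T \<subseteq> \<Union>E"
        using T big_clique_subset_Union unfolding F_def big_clique_iff by auto
      moreover from this have "pairs T = E"
        using \<open>card E = 3\<close> fin by (intro card_seteq) (auto simp: card_pairs numeral_eq_Suc)
      ultimately show ?thesis unfolding pairs_def by blast
    qed
    then have "F 3 \<subseteq> {\<Union>E}" by blast
    then show ?thesis
      by (metis card_mono finite.emptyI finite.insertI is_singletonI is_singleton_altdef)
  qed
  have "card (big_cliques E) \<le> card (F 3) + card (F 4)"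
    unfolding split by (rule card_Un_le)
  moreover have "3 * card (F 3) + 3 * card (F 4) + 9 \<le> 4 * card E"
  \<comment> \<open>Below six edges there is no K4, and rounding down 2m/3 bounds the triangles by 2
    and 3 for m = 4 and 5.\<close>
  proof (cases "card E \<le> 5")
    case True
    then have F4: "card (F 4) = 0" using 4 by linarith
    consider "card E = 3" | "card E = 4" | "card E = 5" using True m by linarith
    then show ?thesis
    proof cases
      case 1
      then show ?thesis using le1[OF 1] F4 by linarith
    next
      case 2
      then have "card (F 3) \<le> 2" using 3 by linarith
      then show ?thesis using 2 F4 by linarith
    next
      case 3
      then have "card (F 3) \<le> 3" using \<open>3 * card (F 3) \<le> 2 * card E\<close> by linarith
      then show ?thesis using 3 F4 by linarith
    qed
  next
    case False
    then show ?thesis using 3 4 by linarith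
  qed
  ultimately show ?thesis by linarith
qed

text \<open>A clique with an edge beyond \<open>T\<close> in each part would join a vertex of one
  part outside \<open>T\<close> to such a vertex of the other. Only \<open>T\<close> is counted in
  both parts.\<close>

lemma big_cliques_glue:
  assumes E: "E = E1 \<union> E2" "E1 \<inter> E2 = pairs T"
    and T: "finite T" "card T = 3"
    and cross: "\<And>e1 e2. e1 \<in> E1 - pairs T \<Longrightarrow> e2 \<in> E2 - pairs T \<Longrightarrow> e1 \<inter> e2 \<subseteq> T"
  shows "big_cliques E = big_cliques E1 \<union> big_cliques E2"
    and "big_cliques E1 \<inter> big_cliques E2 = {T}"
proof -
  have "pairs K \<subseteq> E1 \<or> pairs K \<subseteq> E2" if "pairs K \<subseteq> E" for K
  proof (rule ccontr)
    assume "\<not> ?thesis"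
    then obtain e1 e2 where e: "e1 \<in> pairs K" "e1 \<notin> E2" "e2 \<in> pairs K" "e2 \<notin> E1"
      by blast
    then have e1: "e1 \<in> E1 - pairs T" and e2: "e2 \<in> E2 - pairs T"
      using E that by blast+
    obtain u v where u: "u \<in> e1" "u \<notin> T" and v: "v \<in> e2" "v \<notin> T"
      using e1 e2 e unfolding pairs_def by blast
    have "u \<noteq> v"
      using cross[OF e1 e2] u v by blast
    then have uv: "{u, v} \<in> pairs K"
      using e u v unfolding pairs_def by auto
    \<comment> \<open>The edge \<open>{u, v}\<close> lies in one of the parts and shares a vertex
      outside \<open>T\<close> with the edge \<open>e2\<close> or \<open>e1\<close> of the other
      part.\<close>
    then have "{u, v} \<in> E1 - pairs T \<or> {u, v} \<in> E2 - pairs T"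
      using that E u unfolding pairs_def by blast
    then show False
      using cross[OF _ e2] cross[OF e1] u v by blast
  qed
  then have "pairs K \<subseteq> E \<longleftrightarrow> pairs K \<subseteq> E1 \<or> pairs K \<subseteq> E2" for K
    using E(1) by blast
  then show "big_cliques E = big_cliques E1 \<union> big_cliques E2"
    by (auto simp only: big_clique_iff)
  have "K = T" if "K \<in> big_cliques E1 \<inter> big_cliques E2" for K
  proof -
    have K: "finite K" "3 \<le> card K" "pairs K \<subseteq> pairs T"
      using that E(2) unfolding Int_iff big_clique_iff by auto
    then have "K \<in> big_cliques (pairs T)" by (simp add: big_clique_iff)
    then have "K \<subseteq> T"
      using big_clique_subset_Union unfolding pairs_def by blast
    then show ?thesis
      using K T by (intro card_seteq) auto
  qed
  moreover have "T \<in> big_cliques E1 \<inter> big_cliques E2"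
    using T E by (auto simp: big_clique_iff)
  ultimately show "big_cliques E1 \<inter> big_cliques E2 = {T}" by blast
qed

section \<open>Plane drawings\<close>

text \<open>All conditions concern edges and the vertices they cover, so they pass to every subset
  of \<open>E\<close>, as the induction requires.\<close>

locale plane_drawing =
  fixes pos :: "'a \<Rightarrow> complex" and \<gamma> :: "'a set \<Rightarrow> real \<Rightarrow> complex" and E :: "'a set set"
  assumes finite_E: "finite E"
    and card_edge: "\<forall>e\<in>E. card e = 2"
    and inj_pos: "inj_on pos (\<Union>E)"
    and arc_edge: "e \<in> E \<Longrightarrow> arc (\<gamma> e)"
    and ends_edge: "e \<in> E \<Longrightarrow> {pathstart (\<gamma> e), pathfinish (\<gamma> e)} = pos ` e"
    and edge_Int: "e \<in> E \<Longrightarrow> e' \<in> E \<Longrightarrow> e \<noteq> e' \<Longrightarrow>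
      path_image (\<gamma> e) \<inter> path_image (\<gamma> e') \<subseteq> pos ` (e \<inter> e')"
begin

lemma plane_drawing_subset: "E' \<subseteq> E \<Longrightarrow> plane_drawing pos \<gamma> E'"
  using finite_subset[OF _ finite_E] card_edge inj_on_subset[OF inj_pos Union_mono]
    arc_edge ends_edge edge_Int
  by unfold_locales (simp_all add: subset_iff)

text \<open>The arcs of the drawing are indexed by unordered edges, so
  \<open>\<gamma> {u, v}\<close> may run either way and is reversed if necessary.\<close>

lemma oriented_edge:
  assumes "{u, v} \<in> E"
  obtains g where "arc g" "pathstart g = pos u" "pathfinish g = pos v"
    "path_image g = path_image (\<gamma> {u, v})"
proof -
  have "{pathstart (\<gamma> {u, v}), pathfinish (\<gamma> {u, v})} = {pos u, pos v}"
    using ends_edge[OF assms] by simp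
  then consider "pathstart (\<gamma> {u, v}) = pos u" "pathfinish (\<gamma> {u, v}) = pos v"
    | "pathstart (\<gamma> {u, v}) = pos v" "pathfinish (\<gamma> {u, v}) = pos u"
    by (auto simp: doubleton_eq_iff)
  then show thesis
  proof cases
    case 1
    then show ?thesis using that arc_edge[OF assms] by blast
  next
    case 2
    then show ?thesis
      using that[of "reversepath (\<gamma> {u, v})"] arc_edge[OF assms] by (simp add: arc_reversepath)
  qed
qed

lemma edge_distinct: "{u, v} \<in> E \<Longrightarrow> u \<noteq> v"
  using card_edge by fastforce

lemma pos_in_edge:
  assumes "e \<in> E" "w \<in> e"
  shows "pos w \<in> path_image (\<gamma> e)"
proof -
  have "pos w = pathstart (\<gamma> e) \<or> pos w = pathfinish (\<gamma> e)"
    using ends_edge[OF assms(1)] assms(2) by blast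
  then show ?thesis
    by auto
qed

definition curve :: "'a set \<Rightarrow> complex set" where
  "curve T = (\<Union>e\<in>pairs T. path_image (\<gamma> e))"

text \<open>A common neighbour \<open>x\<close> becomes an arc from \<open>pos u\<close> to
  \<open>pos v\<close>; triangles on one edge thus become arcs with common ends.\<close>

lemma two_edge_path:
  assumes "{u, x} \<in> E" "{x, v} \<in> E" "u \<noteq> v"
  obtains g where "arc g" "pathstart g = pos u" "pathfinish g = pos v"
    "path_image g = path_image (\<gamma> {u, x}) \<union> path_image (\<gamma> {x, v})"
proof -
  obtain g h where g: "arc g" "pathstart g = pos u" "pathfinish g = pos x"
      "path_image g = path_image (\<gamma> {u, x})"
    and h: "arc h" "pathstart h = pos x" "pathfinish h = pos v"
      "path_image h = path_image (\<gamma> {x, v})"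
    using oriented_edge assms by metis
  have "path_image g \<inter> path_image h \<subseteq> pos ` ({u, x} \<inter> {x, v})"
    unfolding g h by (rule edge_Int) (use assms in \<open>auto simp: doubleton_eq_iff\<close>)
  then have "path_image g \<inter> path_image h \<subseteq> {pos x}"
    using assms edge_distinct by auto
  then have "arc (g +++ h)"
    using g h by (intro arc_join) auto
  then show thesis
    using that[of "g +++ h"] g h by (simp add: path_image_join)
qed

lemma curve_triple:
  assumes "{u, v} \<in> E" "{u, x} \<in> E" "{x, v} \<in> E"
  shows "curve {u, v, x} = path_image (\<gamma> {u, v}) \<union> (path_image (\<gamma> {u, x}) \<union> path_image (\<gamma> {x, v}))"
  using assms[THEN edge_distinct] unfolding curve_def
  by (subst pairs_triple) (auto simp: insert_commute)

lemma edge_Int_two_edge_path: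
  assumes "{u, v} \<in> E" "{u, x} \<in> E" "{x, v} \<in> E"
  shows "path_image (\<gamma> {u, v}) \<inter> (path_image (\<gamma> {u, x}) \<union> path_image (\<gamma> {x, v})) \<subseteq> {pos u, pos v}"
proof -
  have d: "u \<noteq> v" "u \<noteq> x" "x \<noteq> v" using assms[THEN edge_distinct] .
  have "path_image (\<gamma> {u, v}) \<inter> path_image (\<gamma> {u, x}) \<subseteq> pos ` ({u, v} \<inter> {u, x})"
    "path_image (\<gamma> {u, v}) \<inter> path_image (\<gamma> {x, v}) \<subseteq> pos ` ({u, v} \<inter> {x, v})"
    by (rule edge_Int; use assms d in \<open>auto simp: doubleton_eq_iff\<close>)+
  then show ?thesis by auto
qed

lemma two_edge_paths_Int:
  assumes "{u, x} \<in> E" "{x, v} \<in> E" "{u, y} \<in> E" "{y, v} \<in> E" "x \<noteq> y" "u \<noteq> v"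
  shows "(path_image (\<gamma> {u, x}) \<union> path_image (\<gamma> {x, v})) \<inter>
    (path_image (\<gamma> {u, y}) \<union> path_image (\<gamma> {y, v})) \<subseteq> {pos u, pos v}"
proof -
  have d: "u \<noteq> x" "x \<noteq> v" "u \<noteq> y" "y \<noteq> v" using assms(1-4)[THEN edge_distinct] .
  have "path_image (\<gamma> {u, x}) \<inter> path_image (\<gamma> {u, y}) \<subseteq> pos ` ({u, x} \<inter> {u, y})"
    "path_image (\<gamma> {u, x}) \<inter> path_image (\<gamma> {y, v}) \<subseteq> pos ` ({u, x} \<inter> {y, v})"
    "path_image (\<gamma> {x, v}) \<inter> path_image (\<gamma> {u, y}) \<subseteq> pos ` ({x, v} \<inter> {u, y})"
    "path_image (\<gamma> {x, v}) \<inter> path_image (\<gamma> {y, v}) \<subseteq> pos ` ({x, v} \<inter> {y, v})"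
    by (rule edge_Int; use assms d in \<open>auto simp: doubleton_eq_iff\<close>)+
  then show ?thesis using assms d by auto
qed

section \<open>Triangles of a drawing and their two sides\<close>

lemma jordan_curve_triangle:
  assumes "pairs T \<subseteq> E" "card T = 3"
  shows "jordan_curve (curve T)"
proof -
  obtain u v x where T: "T = {u, v, x}" "u \<noteq> v" "u \<noteq> x" "v \<noteq> x"
    using assms(2) by (auto simp: card_3_iff)
  then have e: "{u, v} \<in> E" "{u, x} \<in> E" "{x, v} \<in> E"
    using assms(1) unfolding pairs_def by auto
  obtain g where g: "arc g" "pathstart g = pos u" "pathfinish g = pos v"
    "path_image g = path_image (\<gamma> {u, v})"
    using oriented_edge e(1) by metis
  obtain h where h: "arc h" "pathstart h = pos u" "pathfinish h = pos v"
    "path_image h = path_image (\<gamma> {u, x}) \<union> path_image (\<gamma> {x, v})"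
    using two_edge_path e T by metis
  show ?thesis
    unfolding T(1) curve_triple[OF e] g(4)[symmetric] h(4)[symmetric]
    by (rule jordan_curve_join[of _ _ "pos u" "pos v"])
      (use g h edge_Int_two_edge_path[OF e] in auto)
qed

definition empty_side :: "'a set \<Rightarrow> complex set \<Rightarrow> bool" where
  "empty_side T S \<longleftrightarrow> S \<in> sides (curve T) \<and> (\<forall>e\<in>E - pairs T. path_image (\<gamma> e) \<inter> S = {})"

text \<open>Three common neighbours give three triangles on \<open>{u, v}\<close>. An empty side of
  one of them avoids the two-edge paths through the other two neighbours, so
  \<open>no_arc_on_three_empty_sides\<close> applies.\<close>

lemma codegree_le_2:
  assumes empty: "\<And>T. pairs T \<subseteq> E \<Longrightarrow> card T = 3 \<Longrightarrow> \<exists>S. empty_side T S"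
    and uv: "{u, v} \<in> E"
  shows "card {x. {u, x} \<in> E \<and> {x, v} \<in> E} \<le> 2"
proof (rule ccontr)
  let ?N = "{x. {u, x} \<in> E \<and> {x, v} \<in> E}"
  assume "\<not> card ?N \<le> 2"
  then have "3 \<le> card ?N" by simp
  then obtain X where X: "X \<subseteq> ?N" "card X = 3"
    by (rule obtain_subset_with_card_n)
  obtain x y z where xyz: "X = {x, y, z}" and d: "x \<noteq> y" "x \<noteq> z" "y \<noteq> z"
    using X(2) unfolding card_3_iff by blast
  have N: "x \<in> ?N" "y \<in> ?N" "z \<in> ?N"
    using X(1) unfolding xyz by blast+
  let ?B = "\<lambda>w. path_image (\<gamma> {u, w}) \<union> path_image (\<gamma> {w, v})"
  have uv_ne: "u \<noteq> v" using uv edge_distinct by blast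
  have ex_side: "\<exists>S \<in> sides (path_image (\<gamma> {u, v}) \<union> ?B w). \<forall>w'\<in>?N. w' \<noteq> w \<longrightarrow> S \<inter> ?B w' = {}"
    if w: "w \<in> ?N" for w
  proof -
    have e: "{u, w} \<in> E" "{w, v} \<in> E" using w by auto
    then have "u \<noteq> w" "w \<noteq> v" using edge_distinct by blast+
    then have pairs: "pairs {u, v, w} = {{u, v}, {v, w}, {u, w}}" and "card {u, v, w} = 3"
      using uv_ne pairs_triple[of u v w] by auto
    then obtain S where S: "empty_side {u, v, w} S"
      using empty[of "{u, v, w}"] uv e by (auto simp: insert_commute)
    have "S \<inter> ?B w' = {}" if w': "w' \<in> ?N" "w' \<noteq> w" for w'
    proof -
      have "u \<noteq> w'" "w' \<noteq> v" using w' edge_distinct by blast+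
      then have "{u, w'} \<in> E - pairs {u, v, w}" "{w', v} \<in> E - pairs {u, v, w}"
        using w' uv_ne unfolding pairs_def by auto
      then show ?thesis using S unfolding empty_side_def by blast
    qed
    then show ?thesis
      using S unfolding empty_side_def curve_triple[OF uv e] by blast
  qed
  obtain S1 S2 S3 where S: "S1 \<in> sides (path_image (\<gamma> {u, v}) \<union> ?B x)"
      "S2 \<in> sides (path_image (\<gamma> {u, v}) \<union> ?B y)" "S3 \<in> sides (path_image (\<gamma> {u, v}) \<union> ?B z)"
    and SB: "S1 \<inter> (?B y \<union> ?B z) = {}" "S2 \<inter> (?B x \<union> ?B z) = {}" "S3 \<inter> (?B x \<union> ?B y) = {}"
  proof -
    obtain S1 where S1: "S1 \<in> sides (path_image (\<gamma> {u, v}) \<union> ?B x)"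
        "\<forall>w'\<in>?N. w' \<noteq> x \<longrightarrow> S1 \<inter> ?B w' = {}"
      using ex_side[OF N(1)] by (elim bexE) (rule that)
    obtain S2 where S2: "S2 \<in> sides (path_image (\<gamma> {u, v}) \<union> ?B y)"
        "\<forall>w'\<in>?N. w' \<noteq> y \<longrightarrow> S2 \<inter> ?B w' = {}"
      using ex_side[OF N(2)] by (elim bexE) (rule that)
    obtain S3 where S3: "S3 \<in> sides (path_image (\<gamma> {u, v}) \<union> ?B z)"
        "\<forall>w'\<in>?N. w' \<noteq> z \<longrightarrow> S3 \<inter> ?B w' = {}"
      using ex_side[OF N(3)] by (elim bexE) (rule that)
    show ?thesis
    proof (rule that[OF S1(1) S2(1) S3(1)])
      show "S1 \<inter> (?B y \<union> ?B z) = {}"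
        using bspec[OF S1(2) N(2)] bspec[OF S1(2) N(3)] d by (simp add: Int_Un_distrib)
      show "S2 \<inter> (?B x \<union> ?B z) = {}"
        using bspec[OF S2(2) N(1)] bspec[OF S2(2) N(3)] d by (simp add: Int_Un_distrib)
      show "S3 \<inter> (?B x \<union> ?B y) = {}"
        using bspec[OF S3(2) N(1)] bspec[OF S3(2) N(2)] d by (simp add: Int_Un_distrib)
    qed
  qed
  obtain p where p: "arc p" "pathstart p = pos u" "pathfinish p = pos v"
    "path_image p = path_image (\<gamma> {u, v})"
    using oriented_edge uv by metis
  have paths: "\<exists>g. arc g \<and> pathstart g = pos u \<and> pathfinish g = pos v \<and> path_image g = ?B w"
    if "w \<in> ?N" for w
    using that two_edge_path[of u w v] uv_ne by blast
  obtain g1 g2 g3 where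
    g1: "arc g1" "pathstart g1 = pos u" "pathfinish g1 = pos v" "path_image g1 = ?B x" and
    g2: "arc g2" "pathstart g2 = pos u" "pathfinish g2 = pos v" "path_image g2 = ?B y" and
    g3: "arc g3" "pathstart g3 = pos u" "pathfinish g3 = pos v" "path_image g3 = ?B z"
    using paths[OF N(1)] paths[OF N(2)] paths[OF N(3)] by blast
  show False
  proof (rule no_arc_on_three_empty_sides[OF p(1) g1(1) g2(1) g3(1) p(2) g1(2) g2(2) g3(2)
        p(3) g1(3) g2(3) g3(3), unfolded p(4) g1(4) g2(4) g3(4), OF _ _ _ _ _ _ S SB])
    show "path_image (\<gamma> {u, v}) \<inter> ?B x \<subseteq> {pos u, pos v}"
      "path_image (\<gamma> {u, v}) \<inter> ?B y \<subseteq> {pos u, pos v}"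
      "path_image (\<gamma> {u, v}) \<inter> ?B z \<subseteq> {pos u, pos v}"
      using edge_Int_two_edge_path[OF uv] N by blast+
    show "?B x \<inter> ?B y \<subseteq> {pos u, pos v}" "?B x \<inter> ?B z \<subseteq> {pos u, pos v}"
      "?B y \<inter> ?B z \<subseteq> {pos u, pos v}"
      by (rule two_edge_paths_Int; use N d uv_ne in blast)+
  qed
qed

text \<open>The edge meets the triangle only in shared vertices, which are ends of its arc; what
  remains is connected and nonempty, and so lies on exactly one side.\<close>

lemma edge_minus_curve:
  assumes T: "pairs T \<subseteq> E" "card T = 3" and e: "e \<in> E - pairs T"
  shows "path_image (\<gamma> e) \<inter> curve T = pos ` (e \<inter> T)"
    and "connected (path_image (\<gamma> e) - curve T)"
    and "path_image (\<gamma> e) - curve T \<noteq> {}"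
proof -
  have T_cover: "\<exists>f\<in>pairs T. x \<in> f" if x: "x \<in> T" for x
  proof -
    have "T \<in> big_cliques (pairs T)"
      using T(2) card.infinite[of T] by (fastforce simp: big_clique_iff)
    then show ?thesis using big_clique_subset_Union x by blast
  qed
  have "path_image (\<gamma> e) \<inter> path_image (\<gamma> f) \<subseteq> pos ` (e \<inter> T)" if "f \<in> pairs T" for f
  proof -
    have "path_image (\<gamma> e) \<inter> path_image (\<gamma> f) \<subseteq> pos ` (e \<inter> f)"
      using that T(1) e by (intro edge_Int) auto
    then show ?thesis using that unfolding pairs_def by blast
  qed
  moreover have "pos ` (e \<inter> T) \<subseteq> curve T"
    using T_cover pos_in_edge T(1) unfolding curve_def by blast
  ultimately show eq: "path_image (\<gamma> e) \<inter> curve T = pos ` (e \<inter> T)"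
    using pos_in_edge[of e] e unfolding curve_def by blast
  have sub: "pos ` (e \<inter> T) \<subseteq> {pathstart (\<gamma> e), pathfinish (\<gamma> e)}"
    using ends_edge[of e] e by blast
  have diff: "path_image (\<gamma> e) - curve T = path_image (\<gamma> e) - pos ` (e \<inter> T)"
    using eq by blast
  have arc: "arc (\<gamma> e)" using arc_edge e by blast
  show "connected (path_image (\<gamma> e) - curve T)"
    unfolding diff by (rule arc_endless_subset_connected[OF arc sub])
  show "path_image (\<gamma> e) - curve T \<noteq> {}"
    unfolding diff using nonempty_simple_path_endless[OF arc_imp_simple_path[OF arc]] sub by blast
qed

text \<open>Each edge outside the triangle is assigned to the side that it is drawn on. Neither side
  is empty, so each part misses an edge of the other.\<close>

lemma separating_triangle:
  assumes T: "pairs T \<subseteq> E" "card T = 3" and no: "\<nexists>S. empty_side T S"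
  obtains E1 E2 where "E = E1 \<union> E2" "E1 \<inter> E2 = pairs T" "E1 \<noteq> E" "E2 \<noteq> E"
    "\<And>e1 e2. e1 \<in> E1 - pairs T \<Longrightarrow> e2 \<in> E2 - pairs T \<Longrightarrow> e1 \<inter> e2 \<subseteq> T"
proof -
  let ?C = "curve T"
  have J: "jordan_curve ?C" using jordan_curve_triangle T .
  note io = jordan_curve_inside_outside[OF J]
  define P where "P S = {e \<in> E - pairs T. path_image (\<gamma> e) - ?C \<subseteq> S}" for S
  have cover: "e \<in> P (inside ?C) \<or> e \<in> P (outside ?C)" if e: "e \<in> E - pairs T" for e
  proof -
    have "path_image (\<gamma> e) - ?C \<subseteq> S" if "S \<in> sides ?C" "(path_image (\<gamma> e) - ?C) \<inter> S \<noteq> {}" for S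
      using connected_subset_side[OF J edge_minus_curve(2)[OF T e] _ that] by blast
    then show ?thesis
      using edge_minus_curve(3)[OF T e] io e unfolding P_def sides_def by blast
  qed
  have disj: "P (inside ?C) \<inter> P (outside ?C) = {}"
    using edge_minus_curve(3)[OF T] io(1) unfolding P_def by blast
  have "P S \<noteq> {}" if S: "S = inside ?C \<or> S = outside ?C" for S
  proof -
    have side: "S \<in> sides ?C" using S unfolding sides_def by blast
    then obtain e where e: "e \<in> E - pairs T" "path_image (\<gamma> e) \<inter> S \<noteq> {}"
      using no unfolding empty_side_def by blast
    then have "(path_image (\<gamma> e) - ?C) \<inter> S \<noteq> {}"
      using side_disjoint[OF J side] by blast
    then have "path_image (\<gamma> e) - ?C \<subseteq> S"
      using connected_subset_side[OF J edge_minus_curve(2)[OF T e(1)] _ side] by blast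
    then show ?thesis using e unfolding P_def by blast
  qed
  then have ne: "P (inside ?C) \<noteq> {}" "P (outside ?C) \<noteq> {}" by blast+
  have PE: "P S \<subseteq> E" "P S \<inter> pairs T = {}" for S unfolding P_def by blast+
  show thesis
  proof (rule that[of "pairs T \<union> P (inside ?C)" "pairs T \<union> P (outside ?C)"])
    show "E = (pairs T \<union> P (inside ?C)) \<union> (pairs T \<union> P (outside ?C))"
      using cover PE T by blast
    show "(pairs T \<union> P (inside ?C)) \<inter> (pairs T \<union> P (outside ?C)) = pairs T"
      using disj by blast
    show "pairs T \<union> P (inside ?C) \<noteq> E" "pairs T \<union> P (outside ?C) \<noteq> E"
      using disj ne PE by blast+
    fix e1 e2
    assume "e1 \<in> pairs T \<union> P (inside ?C) - pairs T" "e2 \<in> pairs T \<union> P (outside ?C) - pairs T"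
    then have e: "e1 \<in> P (inside ?C)" "e2 \<in> P (outside ?C)" by blast+
    \<comment> \<open>Injectivity keeps a vertex outside \<open>T\<close> off the curve. A shared
      vertex of \<open>e1\<close> and \<open>e2\<close> outside \<open>T\<close> would thus be both
      inside and outside.\<close>
    have out: "pos w \<in> path_image (\<gamma> f) - ?C" if "f \<in> E - pairs T" "w \<in> f" "w \<notin> T" for f w
    proof -
      have "pos w \<in> path_image (\<gamma> f)"
        using pos_in_edge that by blast
      moreover have "pos w \<notin> pos ` (f \<inter> T)"
        using that inj_pos unfolding inj_on_def by blast
      ultimately show ?thesis using edge_minus_curve(1)[OF T that(1)] by blast
    qed
    show "e1 \<inter> e2 \<subseteq> T"
    proof (rule ccontr)
      assume "\<not> e1 \<inter> e2 \<subseteq> T"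
      then obtain w where "w \<in> e1" "w \<in> e2" "w \<notin> T" by blast
      then have "pos w \<in> inside ?C" "pos w \<in> outside ?C"
        using out[of e1 w] out[of e2 w] e unfolding P_def by blast+
      then show False using io(1) by blast
    qed
  qed
qed

end

section \<open>Induction on the number of edges, and the final count\<close>

lemma card_big_cliques_plane_drawing:
  assumes "plane_drawing pos \<gamma> E" "3 \<le> card E"
  shows "3 * card (big_cliques E) + 9 \<le> 4 * card E"
  using assms
proof (induction "card E" arbitrary: E rule: less_induct)
  case less
  interpret plane_drawing pos \<gamma> E by fact
  show ?case
  proof (cases "\<forall>T. pairs T \<subseteq> E \<longrightarrow> card T = 3 \<longrightarrow> (\<exists>S. empty_side T S)")
    case True
    then have "card {x. {u, x} \<in> E \<and> {x, v} \<in> E} \<le> 2" if "{u, v} \<in> E" for u v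
      using that by (intro codegree_le_2) simp_all
    then show ?thesis
      by (rule card_big_cliques_codegree_le_2[OF finite_E card_edge less.prems(2)])
  next
    case False
    then obtain T where T: "pairs T \<subseteq> E" "card T = 3" "\<nexists>S. empty_side T S" by blast
    then obtain E1 E2 where E: "E = E1 \<union> E2" "E1 \<inter> E2 = pairs T" "E1 \<noteq> E" "E2 \<noteq> E"
      and cross: "\<And>e1 e2. e1 \<in> E1 - pairs T \<Longrightarrow> e2 \<in> E2 - pairs T \<Longrightarrow> e1 \<inter> e2 \<subseteq> T"
      using separating_triangle by metis
    have finT: "finite T" using T(2) by (metis card.infinite zero_neq_numeral)
    have fin: "finite E1" "finite E2" using E(1) finite_E by auto
    have lt: "card E1 < card E" "card E2 < card E"
      using E finite_E by (auto intro!: psubset_card_mono)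
    have c3: "card (pairs T) = 3"
      using card_pairs[OF finT] T(2) by (simp add: numeral_eq_Suc)
    \<comment> \<open>Each part contains the triangle, so the induction hypothesis covers
      it.\<close>
    have ge: "3 \<le> card E1" "3 \<le> card E2"
      using card_mono[OF fin(1), of "pairs T"] card_mono[OF fin(2), of "pairs T"] E(2) c3 by auto
    have cE: "card E1 + card E2 = card E + 3"
      using card_Un_Int[OF fin] E(1,2) c3 by simp
    have "plane_drawing pos \<gamma> E1" "plane_drawing pos \<gamma> E2"
      using plane_drawing_subset E(1) by blast+
    then have IH: "3 * card (big_cliques E1) + 9 \<le> 4 * card E1"
        "3 * card (big_cliques E2) + 9 \<le> 4 * card E2"
      using less.hyps lt ge by blast+
    note glue = big_cliques_glue[OF E(1,2) finT T(2) cross]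
    have "finite (big_cliques E1)" "finite (big_cliques E2)"
      using finite_big_cliques fin card_edge E(1) by blast+
    then have "card (big_cliques E1) + card (big_cliques E2) = card (big_cliques E) + 1"
      using card_Un_Int[of "big_cliques E1" "big_cliques E2"] glue by simp
    \<comment> \<open>The constant 9 reproduces itself: the two hypotheses add up to
      \<open>3 * (t + 1) + 18 \<le> 4 * (m + 3)\<close>, that is,
      \<open>3 * t + 9 \<le> 4 * m\<close>.\<close>
    then show ?thesis using IH cE by linarith
  qed
qed

theorem theorem5:
  fixes V :: "'a set" and E :: "'a set set"
  assumes "simple_graph V E" and "planar V E" and "card E \<ge> 3"
  shows "real (num_cliques V E) \<le> real (card V) + 7 / 3 * real (card E) - 2"
proof -
  have V: "finite V" and edge: "\<forall>e\<in>E. e \<subseteq> V \<and> card e = 2"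
    using assms(1) unfolding simple_graph_def by simp_all
  have "E \<subseteq> Pow V"
    using edge by blast
  then have E: "finite E"
    by (rule finite_subset) (simp add: V)
  obtain pos and \<gamma> :: "'a set \<Rightarrow> real \<Rightarrow> complex" where inj: "inj_on pos V"
    and arcs: "\<forall>e\<in>E. arc (\<gamma> e) \<and> {pathstart (\<gamma> e), pathfinish (\<gamma> e)} = pos ` e \<and>
      path_image (\<gamma> e) \<inter> pos ` V = pos ` e"
    and Int: "\<forall>e\<in>E. \<forall>e'\<in>E. e \<noteq> e' \<longrightarrow>
      path_image (\<gamma> e) \<inter> path_image (\<gamma> e') \<subseteq> pos ` (e \<inter> e')"
    using assms(2) unfolding planar_def by (elim exE conjE) (rule that)
  have "inj_on pos (\<Union>E)"
    by (rule inj_on_subset[OF inj]) (use edge in blast)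
  then have "plane_drawing pos \<gamma> E"
    using E edge arcs Int by unfold_locales simp_all
  then have N: "3 * card (big_cliques E) + 9 \<le> 4 * card E"
    using card_big_cliques_plane_drawing assms(3) by blast
  \<comment> \<open>Cliques are sorted by size: the empty one, vertices, edges, and those with at
    least three vertices.\<close>
  have "cliques V E \<subseteq> ({{}} \<union> (\<lambda>x. {x}) ` V) \<union> (E \<union> big_cliques E)"
  proof
    fix K assume K: "K \<in> cliques V E"
    then have KV: "K \<subseteq> V" and adj: "\<forall>x\<in>K. \<forall>y\<in>K. x \<noteq> y \<longrightarrow> {x, y} \<in> E"
      unfolding cliques_def by auto
    then have fin: "finite K" using V finite_subset by blast
    consider "card K = 0" | "card K = 1" | "card K = 2" | "3 \<le> card K" by linarith
    then show "K \<in> ({{}} \<union> (\<lambda>x. {x}) ` V) \<union> (E \<union> big_cliques E)"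
    proof cases
      case 1
      then show ?thesis using fin by simp
    next
      case 2
      then show ?thesis using KV by (auto simp: card_1_singleton_iff)
    next
      case 3
      then show ?thesis using adj by (auto simp: card_2_iff)
    next
      case 4
      then show ?thesis using adj fin unfolding big_cliques_def by blast
    qed
  qed
  then have "num_cliques V E \<le> card (({{}} \<union> (\<lambda>x. {x}) ` V) \<union> (E \<union> big_cliques E))"
    unfolding num_cliques_def using V E finite_big_cliques[OF E] edge by (intro card_mono) auto
  also have "\<dots> \<le> (card {{} :: 'a set} + card ((\<lambda>x. {x}) ` V)) + (card E + card (big_cliques E))"
    by (meson add_mono card_Un_le order_trans)
  also have "\<dots> \<le> 1 + card V + card E + card (big_cliques E)"
    using card_image_le[OF V, of "\<lambda>x. {x}"] by simp
  finally have "num_cliques V E \<le> 1 + card V + card E + card (big_cliques E)" .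
  \<comment> \<open>Three times the count is at most 3 + 3n + 3m + 3t, and 3t is at most 4m -
    9.\<close>
  then have "3 * num_cliques V E + 6 \<le> 3 * card V + 7 * card E"
    using N by linarith
  then show ?thesis
    by (simp add: field_simps flip: of_nat_le_iff[where 'a = real])
qed

end
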